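(* For every integer $n\ge1$, define $t_{1,m}^{(n)}$ ($m\ge 0$) by $$c_1^nc_2^ne^{(\alpha+\beta)x}+c_1^nc_3^ne^{(\alpha+\gamma)x}+c_1^nc_4^ne^{(\alpha+\delta)x}+c_2^nc_3^ne^{(\beta+\gamma)x}+c_2^nc_4^ne^{(\beta+\delta)x}+c_3^nc_4^ne^{(\gamma+\delta)x}=\sum_{m=0}^\infty t_{1,m}^{(n)}\frac{x^m}{m!}.$$ Then for all $m\ge0$ and $n\ge1$, $$t_{1,m}^{(n)}=\frac12\left(\frac1{(A_1^{(n)})^2}\sum_{k=0}^m\binom mkU_k^{(n)}U_{m-k}^{(n)}-\frac{2^m}{A_1^{(2n)}}U_m^{(2n)}\right).$$
   Context: Let $\alpha,\beta,\gamma,\delta$ be the (distinct, complex) roots of $x^4-x^3-x^2-x-1=0$ and $c_1=\frac1{-\alpha^3+6\alpha-1}$, $c_2=\frac1{-\beta^3+6\beta-1}$, $c_3=\frac1{-\gamma^3+6\gamma-1}$, $c_4=\frac1{-\delta^3+6\delta-1}$. (These are the constants with $\sum_{n\ge0}T_n\frac{x^n}{n!}=c_1e^{\alpha x}+c_2e^{\beta x}+c_3e^{\gamma x}+c_4e^{\delta x}$ for the Tetranacci numbers $T_0=0,T_1=T_2=1,T_3=2$, $T_n=T_{n-1}+T_{n-2}+T_{n-3}+T_{n-4}$.) For each $n\ge1$, let $A_1^{(n)}$ be the nonzero rational number and $s_{1,0}^{(n)},s_{1,1}^{(n)},s_{1,2}^{(n)},s_{1,3}^{(n)}$ the integers with greatest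 common divisor $1$ such that $$c_1^ne^{\alpha x}+c_2^ne^{\beta x}+c_3^ne^{\gamma x}+c_4^ne^{\delta x}=\frac1{A_1^{(n)}}\sum_{k=0}^\infty U_k^{(n)}\frac{x^k}{k!},$$ where $U_k^{(n)}=T_{1,k}^{(s_{1,0}^{(n)},s_{1,1}^{(n)},s_{1,2}^{(n)},s_{1,3}^{(n)})}$ is the sequence with $U_j^{(n)}=s_{1,j}^{(n)}$ for $0\le j\le3$ and $U_k^{(n)}=U_{k-1}^{(n)}+U_{k-2}^{(n)}+U_{k-3}^{(n)}+U_{k-4}^{(n)}$ for $k\ge4$; the common sign is fixed by requiring $U_k^{(n)}>0$ for all sufficiently large $k$. Superscripts $(n)$ are indices; $c_i^n$ is an $n$-th power. *)

theory Defs
  imports Complex_Main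
begin

definition tetra_roots :: "complex \<Rightarrow> complex \<Rightarrow> complex \<Rightarrow> complex \<Rightarrow> bool" where
  "tetra_roots \<alpha> \<beta> \<gamma> \<delta> \<longleftrightarrow>
     distinct [\<alpha>, \<beta>, \<gamma>, \<delta>] \<and>
     {x::complex. x ^ 4 - x ^ 3 - x ^ 2 - x - 1 = 0} = {\<alpha>, \<beta>, \<gamma>, \<delta>}"

text \<open>The denominator equals $p'(z)/z^2$ at every root $z$ of $p = x^4 - x^3 - x^2 - x - 1$,
  so it does not vanish there.\<close>
definition tetra_coeff :: "complex \<Rightarrow> complex" where
  "tetra_coeff z = 1 / (- (z ^ 3) + 6 * z - 1)"

fun tetra :: "int \<Rightarrow> int \<Rightarrow> int \<Rightarrow> int \<Rightarrow> nat \<Rightarrow> int" where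
  "tetra s0 s1 s2 s3 0 = s0"
| "tetra s0 s1 s2 s3 (Suc 0) = s1"
| "tetra s0 s1 s2 s3 (Suc (Suc 0)) = s2"
| "tetra s0 s1 s2 s3 (Suc (Suc (Suc 0))) = s3"
| "tetra s0 s1 s2 s3 (Suc (Suc (Suc (Suc k)))) =
     tetra s0 s1 s2 s3 (Suc (Suc (Suc k))) + tetra s0 s1 s2 s3 (Suc (Suc k))
     + tetra s0 s1 s2 s3 (Suc k) + tetra s0 s1 s2 s3 k"

text \<open>The normalisation of the sequence with exponential generating function
  $\sum_i c_i^n e^{\alpha_i x}$: a rational $A \neq 0$ and coprime integer initial values
  $s_0, \dots, s_3$. The last conjunct fixes the common sign of $A$ and the $s_j$.\<close>
definition tetra_normalised ::
  "complex \<Rightarrow> complex \<Rightarrow> complex \<Rightarrow> complex \<Rightarrow> nat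
     \<Rightarrow> rat \<Rightarrow> int \<Rightarrow> int \<Rightarrow> int \<Rightarrow> int \<Rightarrow> bool" where
  "tetra_normalised \<alpha> \<beta> \<gamma> \<delta> n A s0 s1 s2 s3 \<longleftrightarrow>
     A \<noteq> 0 \<and>
     Gcd {s0, s1, s2, s3} = 1 \<and>
     (\<forall>x::complex.
        (\<lambda>k. 1 / of_rat A * (of_int (tetra s0 s1 s2 s3 k) * (x ^ k / fact k))) sums
        (tetra_coeff \<alpha> ^ n * exp (\<alpha> * x) + tetra_coeff \<beta> ^ n * exp (\<beta> * x)
         + tetra_coeff \<gamma> ^ n * exp (\<gamma> * x) + tetra_coeff \<delta> ^ n * exp (\<delta> * x))) \<and>
     (\<forall>\<^sub>F k in sequentially. tetra s0 s1 s2 s3 k > 0)"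

end

theory Submission
  imports Defs "HOL-Analysis.FPS_Convergence"
begin

text \<open>
  Comparing coefficients of exponential generating functions turns the hypotheses into
  closed forms. Write \<open>R\<close> for the set of the four roots and \<open>c z\<close> for the constant
  attached to a root \<open>z\<close>; then \<open>U n k / A n = (\<Sum>z\<in>R. c z ^ n * z ^ k)\<close>, and \<open>t n m\<close> is the sum
  of \<open>c u ^ n * c v ^ n * (u + v) ^ m\<close> over the six unordered pairs of distinct roots
  (\<open>egf_coeff_unique\<close>, \<open>sums_exp_combination\<close>).

  The binomial convolution of two weighted power sums is a double sum of powers of
  \<open>u + v\<close> (\<open>binomial_convolution_power_sums\<close>), which is the coefficient form of
  \<open>exp (u * x) * exp (v * x) = exp ((u + v) * x)\<close>. Applied to \<open>U n / A n\<close> and itself it yields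
  a sum over all ordered pairs of roots. The off-diagonal pairs contribute \<open>2 * t n m\<close>. The
  diagonal pairs contribute \<open>(\<Sum>z\<in>R. c z ^ (2 * n) * (2 * z) ^ m)\<close>, which is
  \<open>2 ^ m * U (2 * n) m / A (2 * n)\<close>. Solving for \<open>t n m\<close> gives the formula.
\<close>

text \<open>
  Both coefficient sequences divided by \<open>fact k\<close> are power series with infinite radius of
  convergence and the same sum, so the identity theorem for power series makes them equal.
\<close>

lemma egf_coeff_unique:
  fixes a b :: "nat \<Rightarrow> complex"
  assumes a: "\<And>x. (\<lambda>k. a k * (x ^ k / fact k)) sums f x"
    and b: "\<And>x. (\<lambda>k. b k * (x ^ k / fact k)) sums f x"
  shows "a k = b k"
proof -
  let ?F = "Abs_fps (\<lambda>k. a k / fact k)" and ?G = "Abs_fps (\<lambda>k. b k / fact k)"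
  have F: "(\<lambda>k. fps_nth ?F k * x ^ k) sums f x" and G: "(\<lambda>k. fps_nth ?G k * x ^ k) sums f x" for x
    using a[of x] b[of x] by simp_all
  have "fps_conv_radius ?F = \<infinity>" "fps_conv_radius ?G = \<infinity>"
    unfolding fps_conv_radius_def
    by (rule conv_radius_inftyI'', use F G sums_summable in blast)+
  moreover have "eval_fps ?F x = eval_fps ?G x" for x
    using F[of x] G[of x] by (simp add: eval_fps_def sums_iff)
  ultimately have "?F = ?G"
    by (intro eval_fps_eqD) auto
  then have "fps_nth ?F k = fps_nth ?G k"
    by simp
  then show ?thesis
    by simp
qed

lemma sums_exp_combination:
  fixes w z :: "'i \<Rightarrow> complex"
  shows "(\<lambda>k. (\<Sum>i\<in>I. w i * z i ^ k) * (x ^ k / fact k)) sums (\<Sum>i\<in>I. w i * exp (z i * x))"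
proof -
  have "(\<lambda>k. \<Sum>i\<in>I. w i * ((z i * x) ^ k /\<^sub>R fact k)) sums (\<Sum>i\<in>I. w i * exp (z i * x))"
    by (intro sums_sum sums_mult exp_converges)
  moreover have "(\<Sum>i\<in>I. w i * ((z i * x) ^ k /\<^sub>R fact k))
      = (\<Sum>i\<in>I. w i * z i ^ k) * (x ^ k / fact k)" for k
    unfolding sum_distrib_right
    by (intro sum.cong refl) (simp add: scaleR_conv_of_real power_mult_distrib field_simps)
  ultimately show ?thesis
    by simp
qed

text \<open>
  After exchanging the sums, the inner sum over \<open>k\<close> is the binomial theorem for
  \<open>(x i + y j) ^ m\<close>.
\<close>

lemma binomial_convolution_power_sums:
  fixes v :: "'i \<Rightarrow> 'a::comm_semiring_1" and w :: "'j \<Rightarrow> 'a"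
  shows "(\<Sum>k = 0..m. of_nat (m choose k) * (\<Sum>i\<in>I. v i * x i ^ k) * (\<Sum>j\<in>J. w j * y j ^ (m - k)))
    = (\<Sum>i\<in>I. \<Sum>j\<in>J. v i * w j * (x i + y j) ^ m)"
proof -
  have "(\<Sum>k = 0..m. of_nat (m choose k) * (\<Sum>i\<in>I. v i * x i ^ k) * (\<Sum>j\<in>J. w j * y j ^ (m - k)))
    = (\<Sum>k = 0..m. \<Sum>i\<in>I. \<Sum>j\<in>J. v i * w j * (of_nat (m choose k) * x i ^ k * y j ^ (m - k)))"
    by (simp add: sum_distrib_left sum_distrib_right mult_ac)
  also have "\<dots> = (\<Sum>i\<in>I. \<Sum>j\<in>J. \<Sum>k = 0..m. v i * w j * (of_nat (m choose k) * x i ^ k * y j ^ (m - k)))"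
    by (subst sum.swap, rule sum.cong[OF refl], rule sum.swap)
  also have "\<dots> = (\<Sum>i\<in>I. \<Sum>j\<in>J. v i * w j * (x i + y j) ^ m)"
    by (simp add: binomial_ring sum_distrib_left atLeast0AtMost)
  finally show ?thesis .
qed

text \<open>
  Distinctness allows the closed form to be a sum over the set of roots: for coinciding
  roots the four exponentials would have more terms than the set has elements.
\<close>

lemma tetra_normalised_closed_form:
  assumes "distinct [\<alpha>, \<beta>, \<gamma>, \<delta>]"
    and "tetra_normalised \<alpha> \<beta> \<gamma> \<delta> n A s0 s1 s2 s3"
  shows "of_int (tetra s0 s1 s2 s3 k) / of_rat A
    = (\<Sum>z\<in>{\<alpha>, \<beta>, \<gamma>, \<delta>}. tetra_coeff z ^ n * z ^ k)"
proof (rule egf_coeff_unique)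
  fix x :: complex
  let ?f = "\<lambda>x. \<Sum>z\<in>{\<alpha>, \<beta>, \<gamma>, \<delta>}. tetra_coeff z ^ n * exp (z * x)"
  show "(\<lambda>k. (\<Sum>z\<in>{\<alpha>, \<beta>, \<gamma>, \<delta>}. tetra_coeff z ^ n * z ^ k) * (x ^ k / fact k)) sums ?f x"
    by (rule sums_exp_combination)
  show "(\<lambda>k. of_int (tetra s0 s1 s2 s3 k) / of_rat A * (x ^ k / fact k)) sums ?f x"
    using assms by (simp add: tetra_normalised_def add.assoc)
qed

theorem theorem12:
  fixes \<alpha> \<beta> \<gamma> \<delta> c1 c2 c3 c4 :: complex
    and A :: "nat \<Rightarrow> rat"
    and s0 s1 s2 s3 :: "nat \<Rightarrow> int"
    and U :: "nat \<Rightarrow> nat \<Rightarrow> int"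
    and t :: "nat \<Rightarrow> nat \<Rightarrow> complex"
  assumes roots: "tetra_roots \<alpha> \<beta> \<gamma> \<delta>"
    and c: "c1 = tetra_coeff \<alpha>" "c2 = tetra_coeff \<beta>" "c3 = tetra_coeff \<gamma>" "c4 = tetra_coeff \<delta>"
    and normalised: "\<And>n. n \<ge> 1 \<Longrightarrow>
          tetra_normalised \<alpha> \<beta> \<gamma> \<delta> n (A n) (s0 n) (s1 n) (s2 n) (s3 n)"
    and U: "\<And>n k. n \<ge> 1 \<Longrightarrow> U n k = tetra (s0 n) (s1 n) (s2 n) (s3 n) k"
    and t: "\<And>n (x::complex). n \<ge> 1 \<Longrightarrow>
          (\<lambda>m. t n m * (x ^ m / fact m)) sums
          (c1 ^ n * c2 ^ n * exp ((\<alpha> + \<beta>) * x) + c1 ^ n * c3 ^ n * exp ((\<alpha> + \<gamma>) * x)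
           + c1 ^ n * c4 ^ n * exp ((\<alpha> + \<delta>) * x) + c2 ^ n * c3 ^ n * exp ((\<beta> + \<gamma>) * x)
           + c2 ^ n * c4 ^ n * exp ((\<beta> + \<delta>) * x) + c3 ^ n * c4 ^ n * exp ((\<gamma> + \<delta>) * x))"
  shows "\<forall>m n. n \<ge> 1 \<longrightarrow>
          t n m = 1 / 2 *
            (1 / (of_rat (A n)) ^ 2
               * (\<Sum>k = 0..m. of_nat (m choose k) * of_int (U n k) * of_int (U n (m - k)))
             - 2 ^ m / of_rat (A (2 * n)) * of_int (U (2 * n) m))"
proof (intro allI impI)
  fix m n :: nat
  assume n: "n \<ge> 1"
  let ?R = "{\<alpha>, \<beta>, \<gamma>, \<delta>}"
  let ?P = "{(\<alpha>, \<beta>), (\<alpha>, \<gamma>), (\<alpha>, \<delta>), (\<beta>, \<gamma>), (\<beta>, \<delta>), (\<gamma>, \<delta>)}"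
  let ?w = "\<lambda>(u, v). tetra_coeff u ^ n * tetra_coeff v ^ n"
  let ?s = "\<lambda>(u, v). u + v"
  let ?g = "\<lambda>u v. tetra_coeff u ^ n * tetra_coeff v ^ n * (u + v) ^ m"
  have dist: "distinct [\<alpha>, \<beta>, \<gamma>, \<delta>]"
    using roots by (simp add: tetra_roots_def)
  have U_closed: "of_int (U l k) / of_rat (A l) = (\<Sum>z\<in>?R. tetra_coeff z ^ l * z ^ k)"
    if "l \<ge> 1" for l k
    using tetra_normalised_closed_form[OF dist normalised[OF that]] U[OF that] by simp
  have "t n m = (\<Sum>p\<in>?P. ?w p * ?s p ^ m)"
  proof (rule egf_coeff_unique)
    fix x :: complex
    show "(\<lambda>k. (\<Sum>p\<in>?P. ?w p * ?s p ^ k) * (x ^ k / fact k)) sums (\<Sum>p\<in>?P. ?w p * exp (?s p * x))"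
      by (rule sums_exp_combination)
    show "(\<lambda>k. t n k * (x ^ k / fact k)) sums (\<Sum>p\<in>?P. ?w p * exp (?s p * x))"
      using t[OF n, of x] dist by (simp add: c add.assoc)
  qed
  then have t_closed: "t n m = (\<Sum>(u, v)\<in>?P. ?g u v)"
    by (simp add: case_prod_unfold)
  have "1 / (of_rat (A n)) ^ 2
      * (\<Sum>k = 0..m. of_nat (m choose k) * of_int (U n k) * of_int (U n (m - k)))
    = (\<Sum>k = 0..m. of_nat (m choose k) * (of_int (U n k) / of_rat (A n))
        * (of_int (U n (m - k)) / of_rat (A n)))"
    by (simp add: sum_distrib_left power2_eq_square)
  also have "\<dots> = (\<Sum>u\<in>?R. \<Sum>v\<in>?R. ?g u v)"
    unfolding U_closed[OF n] by (rule binomial_convolution_power_sums)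
  \<comment> \<open>\<open>?g\<close> is symmetric, so each pair in \<open>?P\<close> accounts for both of its orderings.\<close>
  also have "\<dots> = (\<Sum>z\<in>?R. ?g z z) + 2 * (\<Sum>(u, v)\<in>?P. ?g u v)"
    using dist by (simp add: add_ac mult_ac)
  also have "(\<Sum>z\<in>?R. ?g z z) = 2 ^ m * (\<Sum>z\<in>?R. tetra_coeff z ^ (2 * n) * z ^ m)"
    unfolding sum_distrib_left
    by (intro sum.cong refl) (simp add: power_mult_distrib flip: power_add mult_2)
  also have "(\<Sum>z\<in>?R. tetra_coeff z ^ (2 * n) * z ^ m) = of_int (U (2 * n) m) / of_rat (A (2 * n))"
    using U_closed[of "2 * n" m] n by simp
  finally show "t n m = 1 / 2 *
            (1 / (of_rat (A n)) ^ 2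
               * (\<Sum>k = 0..m. of_nat (m choose k) * of_int (U n k) * of_int (U n (m - k)))
             - 2 ^ m / of_rat (A (2 * n)) * of_int (U (2 * n) m))"
    unfolding t_closed by simp
qed

end
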